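(* Let $(X,d,\mu)$ be a metric space with a doubling Borel regular measure $\mu$ with doubling constant $c_\mu$. Let $f$ be a non-negative locally integrable function on $X$. Fix a ball $B_0=B(x_0,R)$ and assume that $$\lambda_0\geq \frac{1}{\mu(B_0)}\int_{11B_0} f\,d\mu.$$ Then there exists a countable, possibly finite, family of pairwise disjoint balls $\{B_i\}_i$ with centers in $B_0$ and satisfying $5B_i\subset 11B_0$ such that (i) $f(x)\leq\lambda_0$ for $\mu$-a.e. $x\in B_0\setminus\bigcup_i 5B_i$; (ii) $\lambda_0<\frac{1}{\mu(B_i)}\int_{B_i} f\,d\mu\leq c_\mu^3\lambda_0$ for every $i$; (iii) $c_\mu^{-3}\lambda_0<\frac{1}{\mu(5B_i)}\int_{5B_i} f\,d\mu\leq\lambda_0$ for every $i$. A countable, possibly finite, family of pairwise disjoint balls $\{B_i\}_i$ with centers in $B_0$, satisfying $5B_i\subset 11B_0$ and conditions (i), (ii) and (iii), is called a family of Calderón–Zygmund balls at level $\lambda_0$. Moreover, if $\lambda_0\leq\lambda_1\leq\ldots\leq\lambda_N$, then families $\{B_i(\lambda_n)\}_i$ of Calderón–Zygmund balls at the levels $\lambda_n$, $n=0,\ldots,N$, may be chosen in such a way that, for each $n=0,\ldots,N-1$, each ball $B_i(\lambda_{n+1})$ is contained in some $5B_j(\lambda_n)$.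
   Context: A ball is an open ball $B=B(x,r)=\{y\in X: d(y,x)<r\}$, $r>0$, always understood to come with a specified center $x$ and radius $r$; for $\lambda>0$, $\lambda B$ denotes the ball with the same center and radius $\lambda r$. The measure $\mu$ is doubling: every ball has positive and finite measure, and there is a constant $c_\mu\geq 1$ (the doubling constant) such that $\mu(2B)\leq c_\mu\,\mu(B)$ for all balls $B$ in $X$. Locally integrable on $X$ means integrable over every ball. *)

theory Defs
  imports "HOL-Analysis.Analysis"
begin

(* A Borel regular (outer) measure mu is modelled by a measure M on a sigma-algebra of
   mu-measurable sets; mu itself is then outer_measure_of M. *)
definition borel_regular :: "'a::topological_space measure \<Rightarrow> bool" where
  "borel_regular M \<longleftrightarrow>
     space M = UNIV \<and> sets borel \<subseteq> sets M \<and>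
     (\<forall>A. \<exists>B\<in>sets borel. A \<subseteq> B \<and> emeasure M B = outer_measure_of M A)"

definition doubling :: "'a::metric_space measure \<Rightarrow> real \<Rightarrow> bool" where
  "doubling M c \<longleftrightarrow>
     c \<ge> 1 \<and>
     (\<forall>x r. r > 0 \<longrightarrow>
        0 < emeasure M (ball x r) \<and> emeasure M (ball x r) < \<infinity> \<and>
        emeasure M (ball x (2 * r)) \<le> ennreal c * emeasure M (ball x r))"

definition locally_integrable :: "'a::metric_space measure \<Rightarrow> ('a \<Rightarrow> real) \<Rightarrow> bool" where
  "locally_integrable M f \<longleftrightarrow> (\<forall>x r. r > 0 \<longrightarrow> set_integrable M (ball x r) f)"

definition average :: "'a measure \<Rightarrow> ('a \<Rightarrow> real) \<Rightarrow> 'a set \<Rightarrow> real" where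
  "average M f A = (LINT y:A|M. f y) / measure M A"

(* A ball carries its center and radius, so a family of balls is a set of pairs (x, r).
   Distinct pairs must give disjoint balls; as balls are nonempty, this is the same as
   pairwise disjointness of an indexed family. *)
definition CZ_balls ::
  "'a::metric_space measure \<Rightarrow> real \<Rightarrow> ('a \<Rightarrow> real) \<Rightarrow> 'a \<Rightarrow> real \<Rightarrow> real \<Rightarrow> ('a \<times> real) set \<Rightarrow> bool"
where
  "CZ_balls M c f x0 R lam F \<longleftrightarrow>
     countable F \<and>
     (\<forall>(x, r)\<in>F. r > 0 \<and> x \<in> ball x0 R \<and> ball x (5 * r) \<subseteq> ball x0 (11 * R)) \<and>
     disjoint_family_on (\<lambda>(x, r). ball x r) F \<and>
     (AE x in M. x \<in> ball x0 R - (\<Union>(y, r)\<in>F. ball y (5 * r)) \<longrightarrow> f x \<le> lam) \<and>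
     (\<forall>(x, r)\<in>F. lam < average M f (ball x r) \<and> average M f (ball x r) \<le> c ^ 3 * lam) \<and>
     (\<forall>(x, r)\<in>F. c powi (-3) * lam < average M f (ball x (5 * r)) \<and>
                 average M f (ball x (5 * r)) \<le> lam)"

end

theory Submission
  imports Defs
begin

text \<open>
  The proof is a stopping-time argument. Fix a level \<open>lam \<ge> lam0\<close>. For a center \<open>x\<close> in
  \<open>B0\<close>, look at the averages of \<open>f\<close> over the balls around \<open>x\<close> of radii \<open>10 R / 5 ^ k\<close>,
  \<open>k = 0, 1, 2, \<dots>\<close>. The first of these balls contains \<open>B0\<close> and lies in \<open>11 B0\<close>, so its average
  is at most \<open>lam0\<close> (\<open>average_10_le\<close>). Stop at the first \<open>k\<close> for which the average exceeds
  \<open>lam\<close>. The stopped ball \<open>B\<close> then has average above \<open>lam\<close>, while \<open>5 B\<close>, the ball one step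
  earlier, has average at most \<open>lam\<close>. As \<open>5 B\<close> has measure at most \<open>c\<^sup>3\<close> times that of \<open>B\<close>
  (three doublings reach the factor 8), these two inequalities imply the other two bounds
  (\<open>average_le_average_5\<close>). A Vitali selection from the stopped balls (\<open>vitali_5r_covering\<close>)
  gives the required disjoint family, which is countable because its members are disjoint sets of
  positive measure in a ball of finite measure.

  A point of \<open>B0\<close> outside the enlarged balls is never stopped, so there are arbitrarily
  small balls around that point over which \<open>f\<close> has average at most \<open>lam\<close>. By a one-sided form of the Lebesgue differentiation
  theorem (\<open>AE_le_if_small_averages_le\<close>), \<open>f \<le> lam\<close> holds at almost every such point.
  This form follows from the same Vitali selection together with outer regularity by open sets
  (\<open>open_outer_approx\<close>): small disjoint balls with low averages must leave a fixed proportion of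
  their measure outside the set where \<open>f\<close> is large, and an open set that approximates this set
  closely has no room for that.

  The nesting for increasing levels holds for any choice of the Vitali selections: an
  average above the higher level is also above the lower one, so a center that is stopped at the higher
  level was stopped at the lower level with at least the same radius. Its larger ball, which
  contains the smaller one, is in turn swallowed by an enlarged ball of the lower family
  (\<open>vitali_subfamily_nested\<close>).
\<close>

section \<open>The Vitali covering lemma\<close>

text \<open>
  The subfamily is a maximal good one, given by Zorn's lemma. A subfamily \<open>D\<close> is called good if it
  is disjoint and every ball of \<open>F\<close> that meets some member of \<open>D\<close> already meets one of at least half its radius. Two intersecting balls
  \<open>ball x r\<close> and \<open>ball y s\<close> with \<open>r \<le> 2 s\<close> satisfy \<open>ball x r \<subseteq> ball y (5 s)\<close>, because
  \<open>s + 2 r \<le> 5 s\<close>.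
\<close>

lemma vitali_5r_covering:
  fixes F :: "('a::metric_space \<times> real) set"
  assumes pos: "\<And>x r. (x, r) \<in> F \<Longrightarrow> 0 < r" and bdd: "\<And>x r. (x, r) \<in> F \<Longrightarrow> r \<le> b"
  obtains D where "D \<subseteq> F" "disjoint_family_on (\<lambda>(x, r). ball x r) D"
    "\<And>x r. (x, r) \<in> F \<Longrightarrow> \<exists>(y, s)\<in>D. ball x r \<subseteq> ball y (5 * s)"
proof -
  define B :: "'a \<times> real \<Rightarrow> 'a set" where "B = (\<lambda>p. ball (fst p) (snd p))"
  define good where "good D \<longleftrightarrow> D \<subseteq> F \<and> disjoint_family_on B D \<and>
    (\<forall>p\<in>F. (\<exists>q\<in>D. B p \<inter> B q \<noteq> {}) \<longrightarrow> (\<exists>q\<in>D. B p \<inter> B q \<noteq> {} \<and> snd p \<le> 2 * snd q))" for D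
  have "\<exists>D\<in>Collect good. \<forall>X\<in>Collect good. D \<subseteq> X \<longrightarrow> X = D"
  proof (rule subset_Zorn')
    fix C assume "subset.chain (Collect good) C"
    then have C: "\<And>D. D \<in> C \<Longrightarrow> good D" and lin: "\<And>D E. D \<in> C \<Longrightarrow> E \<in> C \<Longrightarrow> D \<subseteq> E \<or> E \<subseteq> D"
      by (auto simp: subset.chain_def)
    have "disjoint_family_on B (\<Union>C)"
      unfolding disjoint_family_on_def
    proof (intro ballI impI)
      fix p q assume "p \<in> \<Union>C" "q \<in> \<Union>C" and pq: "p \<noteq> q"
      then obtain E where "E \<in> C" "p \<in> E" "q \<in> E"
        using lin by blast
      then show "B p \<inter> B q = {}"
        using C[of E] pq by (auto simp: good_def disjoint_family_on_def)
    qed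
    moreover have "\<Union>C \<subseteq> F"
      using C unfolding good_def by (intro Sup_least) blast
    moreover have "\<exists>q\<in>\<Union>C. B p \<inter> B q \<noteq> {} \<and> snd p \<le> 2 * snd q"
      if "p \<in> F" "\<exists>q\<in>\<Union>C. B p \<inter> B q \<noteq> {}" for p
    proof -
      from that obtain E where E: "E \<in> C" "\<exists>q\<in>E. B p \<inter> B q \<noteq> {}"
        by blast
      with C[of E] \<open>p \<in> F\<close> have "\<exists>q\<in>E. B p \<inter> B q \<noteq> {} \<and> snd p \<le> 2 * snd q"
        by (simp add: good_def)
      with E(1) show ?thesis by blast
    qed
    ultimately show "\<Union>C \<in> Collect good"
      by (simp add: good_def)
  qed
  then obtain D where D: "good D" and max: "\<And>X. good X \<Longrightarrow> D \<subseteq> X \<Longrightarrow> X = D"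
    by auto
  \<comment> \<open>A maximal good family meets every ball of \<open>F\<close>: otherwise a ball whose radius is more than
     half the supremum over all balls that miss \<open>D\<close> could be added.\<close>
  have meets: "\<exists>q\<in>D. B p \<inter> B q \<noteq> {}" if "p \<in> F" for p
  proof (rule ccontr)
    define N where "N = {p\<in>F. \<forall>q\<in>D. B p \<inter> B q = {}}"
    assume "\<not> ?thesis"
    with that have pN: "p \<in> N" by (auto simp: N_def)
    have ub: "bdd_above (snd ` N)"
      using bdd by (auto simp: N_def bdd_above_def intro!: exI[of _ b])
    have "0 < snd p" using pos[of "fst p" "snd p"] that by simp
    also have "snd p \<le> (SUP q\<in>N. snd q)" using pN ub by (rule cSUP_upper)
    finally have "(SUP q\<in>N. snd q) / 2 < (SUP q\<in>N. snd q)" by simp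
    then obtain q where q: "q \<in> N" "(SUP q\<in>N. snd q) / 2 < snd q"
      using less_cSUP_iff[OF _ ub] pN by blast
    have half: "snd p \<le> 2 * snd q" if "p \<in> N" for p
      using cSUP_upper[OF that ub] q(2) by simp
    have self: "B q \<inter> B q \<noteq> {}"
      using pos[of "fst q" "snd q"] q(1) by (auto simp: B_def N_def)
    have "good (insert q D)"
      unfolding good_def
    proof (intro conjI ballI impI)
      show "insert q D \<subseteq> F" using D q by (auto simp: good_def N_def)
      show "disjoint_family_on B (insert q D)"
        using D q(1) unfolding good_def disjoint_family_on_def N_def by blast
      fix p assume p: "p \<in> F" "\<exists>q'\<in>insert q D. B p \<inter> B q' \<noteq> {}"
      show "\<exists>q'\<in>insert q D. B p \<inter> B q' \<noteq> {} \<and> snd p \<le> 2 * snd q'"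
      proof (cases "p \<in> N")
        case True
        with p half[of p] show ?thesis by (auto simp: N_def)
      next
        case False
        with p(1) D show ?thesis by (auto simp: N_def good_def)
      qed
    qed
    with max[of "insert q D"] have "q \<in> D" by blast
    with q(1) self show False by (auto simp: N_def)
  qed
  show thesis
  proof (rule that)
    show "D \<subseteq> F" using D by (simp add: good_def)
    show "disjoint_family_on (\<lambda>(x, r). ball x r) D"
      using D by (simp add: good_def B_def case_prod_unfold)
    fix x r assume xr: "(x, r) \<in> F"
    from meets[OF xr] xr D obtain q where q: "q \<in> D" "B (x, r) \<inter> B q \<noteq> {}" "r \<le> 2 * snd q"
      unfolding good_def by force
    obtain y s where ys: "q = (y, s)" by (cases q)
    from q ys obtain z where z: "dist x z < r" "dist y z < s" "r \<le> 2 * s"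
      by (auto simp: B_def)
    have "ball x r \<subseteq> ball y (5 * s)"
    proof
      fix w assume "w \<in> ball x r"
      then have w: "dist x w < r" by simp
      have "dist y w \<le> dist y z + dist x z + dist x w"
        using dist_triangle[of y w z] dist_triangle[of z w x] by (simp add: dist_commute)
      with w z show "w \<in> ball y (5 * s)" by simp
    qed
    with q ys show "\<exists>(y, s)\<in>D. ball x r \<subseteq> ball y (5 * s)" by blast
  qed
qed

section \<open>Outer regularity by open sets\<close>

text \<open>
  The sets that can be squeezed between closed and open sets form a \<open>\<sigma>\<close>-algebra; keeping the closed
  set in the statement makes it symmetric under complements. A closed set belongs to it since it is
  the intersection of its open \<open>1 / n\<close>-neighborhoods.
\<close>

lemma borel_approx_open_closed:
  fixes N :: "'a::metric_space measure"
  assumes fin: "finite_measure N" and sb: "sets borel \<subseteq> sets N"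
    and A: "A \<in> sets borel" and e: "0 < e"
  obtains U K where "open U" "closed K" "K \<subseteq> A" "A \<subseteq> U" "measure N (U - K) < e"
proof -
  interpret finite_measure N by (rule fin)
  have bo [measurable]: "open S \<Longrightarrow> S \<in> sets N" "closed S \<Longrightarrow> S \<in> sets N" for S
    using sb by auto
  have "A \<in> sigma_sets UNIV {S::'a set. closed S}"
    using A by (simp add: borel_eq_closed)
  then have "\<forall>e>0. \<exists>U K. open U \<and> closed K \<and> K \<subseteq> A \<and> A \<subseteq> U \<and> measure N (U - K) < e"
  proof induction
    case (Basic A)
    show ?case
    proof (intro allI impI)
      fix e :: real assume "0 < e"
      define V where "V n = (\<Union>a\<in>A. ball a (1 / Suc n))" for n :: nat
      have V: "open (V n)" "A \<subseteq> V n" for n by (auto simp: V_def intro!: open_UN)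
      have cl: "x \<in> A" if "\<forall>n. x \<in> V n" for x
      proof -
        have "x \<in> closure A"
          unfolding closure_approachable
        proof (intro allI impI)
          fix d :: real assume "0 < d"
          then obtain n where n: "1 / Suc n < d" using nat_approx_posE by blast
          from that obtain a where "a \<in> A" "dist a x < 1 / Suc n" by (auto simp: V_def)
          with n show "\<exists>y\<in>A. dist y x < d" by (intro bexI[of _ a]) auto
        qed
        with Basic show ?thesis by simp
      qed
      have "(\<lambda>n. measure N (V n - A)) \<longlonglongrightarrow> measure N (\<Inter>n. V n - A)"
      proof (rule finite_Lim_measure_decseq)
        show "range (\<lambda>n. V n - A) \<subseteq> sets N" using V Basic by auto
        have "1 / real (Suc n) \<le> 1 / real (Suc m)" if "m \<le> n" for m n
          using that by (simp add: field_simps)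
        then show "decseq (\<lambda>n. V n - A)"
          unfolding decseq_def V_def by (fastforce intro: less_le_trans)
      qed
      also have "(\<Inter>n. V n - A) = {}" using cl by auto
      finally have "(\<lambda>n. measure N (V n - A)) \<longlonglongrightarrow> 0" by simp
      then have "\<forall>\<^sub>F n in sequentially. measure N (V n - A) < e"
        using \<open>0 < e\<close> by (rule order_tendstoD)
      then obtain n where "measure N (V n - A) < e"
        using eventually_sequentially by auto
      with V Basic show "\<exists>U K. open U \<and> closed K \<and> K \<subseteq> A \<and> A \<subseteq> U \<and> measure N (U - K) < e"
        by blast
    qed
  next
    case Empty
    show ?case by (intro allI impI exI[of _ "{}"]) auto
  next
    case (Compl A)
    show ?case
    proof (intro allI impI)
      fix e :: real assume "0 < e"
      with Compl.IH have "\<exists>U K. open U \<and> closed K \<and> K \<subseteq> A \<and> A \<subseteq> U \<and> measure N (U - K) < e"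
        by simp
      then obtain U K where "open U" "closed K" "K \<subseteq> A" "A \<subseteq> U" "measure N (U - K) < e"
        by auto
      moreover have "- K - - U = U - K" by auto
      ultimately show "\<exists>U K. open U \<and> closed K \<and> K \<subseteq> UNIV - A \<and> UNIV - A \<subseteq> U \<and> measure N (U - K) < e"
        by (intro exI[of _ "- K"] exI[of _ "- U"]) (auto simp: open_Compl closed_Compl)
    qed
  next
    case (Union A)
    show ?case
    proof (intro allI impI)
      fix e :: real assume e: "0 < e"
      have "\<forall>i. \<exists>U K. open U \<and> closed K \<and> K \<subseteq> A i \<and> A i \<subseteq> U \<and> measure N (U - K) < (e / 2) * (1 / 2) ^ Suc i"
      proof
        fix i
        have "0 < (e / 2) * (1 / 2) ^ Suc i" using e by simp
        with Union.IH[of i] show "\<exists>U K. open U \<and> closed K \<and> K \<subseteq> A i \<and> A i \<subseteq> U \<and>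
            measure N (U - K) < (e / 2) * (1 / 2) ^ Suc i"
          by blast
      qed
      then obtain U K where UK: "\<And>i. open (U i)" "\<And>i. closed (K i)" "\<And>i. K i \<subseteq> A i" "\<And>i. A i \<subseteq> U i"
        "\<And>i. measure N (U i - K i) < (e / 2) * (1 / 2) ^ Suc i"
        by metis
      have [measurable]: "U i \<in> sets N" "K i \<in> sets N" for i using UK by auto
      \<comment> \<open>An infinite union of closed sets need not be closed, so it is cut off after finitely many.\<close>
      define L where "L n = (\<Union>i\<le>n. K i)" for n
      have L: "closed (L n)" "L n \<subseteq> (\<Union>i. A i)" for n
        using UK(2,3) by (auto simp: L_def intro!: closed_UN)
      have [measurable]: "L n \<in> sets N" for n using L by auto
      have lim: "(\<lambda>n. measure N (\<Union>(range U) - L n)) \<longlonglongrightarrow> measure N (\<Inter>n. \<Union>(range U) - L n)"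
        by (rule finite_Lim_measure_decseq) (fastforce simp: decseq_def L_def)+
      have "measure N (\<Inter>n. \<Union>(range U) - L n) \<le> e / 2"
      proof -
        have sm: "(\<lambda>i. (e / 2) * (1 / 2) ^ Suc i) sums (e / 2)"
          using sums_mult[OF power_half_series, of "e / 2"] by simp
        have s1: "summable (\<lambda>i. measure N (U i - K i))"
          using UK(5) by (intro summable_comparison_test'[OF sums_summable[OF sm]]) (auto intro: less_imp_le)
        have "measure N (\<Inter>n. \<Union>(range U) - L n) \<le> measure N (\<Union>i. U i - K i)"
          by (rule finite_measure_mono) (auto simp: L_def)
        also have "\<dots> \<le> (\<Sum>i. measure N (U i - K i))"
          by (rule finite_measure_subadditive_countably) (use s1 in auto)
        also have "\<dots> \<le> (\<Sum>i. (e / 2) * (1 / 2) ^ Suc i)"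
          by (rule suminf_le[OF _ s1 sums_summable[OF sm]]) (use UK(5) less_imp_le in blast)
        also have "\<dots> = e / 2" using sm by (rule sums_unique[symmetric])
        finally show ?thesis .
      qed
      then have "\<forall>\<^sub>F n in sequentially. measure N (\<Union>(range U) - L n) < e"
        using e by (intro order_tendstoD(2)[OF lim]) simp
      then obtain n where "measure N (\<Union>(range U) - L n) < e"
        using eventually_sequentially by auto
      moreover have "open (\<Union>(range U))" "(\<Union>i. A i) \<subseteq> \<Union>(range U)" using UK(1,4) by (auto intro!: open_UN)
      ultimately show "\<exists>U K. open U \<and> closed K \<and> K \<subseteq> \<Union>(range A) \<and> \<Union>(range A) \<subseteq> U \<and> measure N (U - K) < e"
        using L by (intro exI[of _ "\<Union>(range U)"] exI[of _ "L n"] conjI)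
    qed
  qed
  with e have "\<exists>U K. open U \<and> closed K \<and> K \<subseteq> A \<and> A \<subseteq> U \<and> measure N (U - K) < e"
    by simp
  then show thesis using that by auto
qed

text \<open>
  The measure is cut down to \<open>W\<close> to make it finite. Borel regularity passes from the measurable set
  \<open>S\<close> to a Borel set that differs from it by a null set.
\<close>

lemma open_outer_approx:
  fixes M :: "'a::metric_space measure"
  assumes br: "borel_regular M" and W: "open W" "emeasure M W < \<infinity>"
    and S: "S \<in> sets M" "S \<subseteq> W" and e: "0 < e"
  obtains U where "open U" "S \<subseteq> U" "U \<subseteq> W" "emeasure M (U - S) < ennreal e"
proof -
  have sb: "sets borel \<subseteq> sets M" and sp: "space M = UNIV"
    using br by (auto simp: borel_regular_def)
  have WM [measurable]: "W \<in> sets M" using sb W by auto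
  obtain C where C: "C \<in> sets borel" "S \<subseteq> C" "emeasure M C = outer_measure_of M S"
    using br unfolding borel_regular_def by blast
  have CM [measurable]: "C \<in> sets M" using sb C by auto
  have fS: "emeasure M S \<noteq> \<infinity>"
    using emeasure_mono[OF S(2) WM] W(2) by (auto simp: top_unique)
  have nul: "emeasure M (C - S) = 0"
    using C S fS by (simp add: emeasure_Diff)
  define N where "N = density M (indicator W)"
  have N: "emeasure N X = emeasure M (X \<inter> W)" if "X \<in> sets M" for X
  proof -
    have "emeasure N X = (\<integral>\<^sup>+x. indicator (X \<inter> W) x \<partial>M)"
      unfolding N_def using that
      by (subst emeasure_density) (auto simp del: nn_integral_indicator intro!: nn_integral_cong split: split_indicator)
    then show ?thesis using that by simp
  qed
  have [simp]: "sets N = sets M" "space N = space M" by (simp_all add: N_def)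
  interpret N: finite_measure N
    by (rule finite_measureI) (use W(2) N[of UNIV] sp sets.top[of M] in auto)
  obtain U K where UK: "open U" "closed K" "K \<subseteq> C" "C \<subseteq> U" "measure N (U - K) < e"
    using borel_approx_open_closed[OF N.finite_measure_axioms _ C(1) e] sb by auto
  have [measurable]: "U \<in> sets M" "K \<in> sets M" using UK sb by auto
  have "emeasure M (U \<inter> W - S) \<le> emeasure M ((U - K) \<inter> W \<union> (C - S))"
    using UK S by (intro emeasure_mono) auto
  also have "\<dots> \<le> emeasure M ((U - K) \<inter> W) + emeasure M (C - S)"
    using S by (intro emeasure_subadditive) auto
  also have "\<dots> = ennreal (measure N (U - K))"
    using N[of "U - K"] nul by (simp add: N.emeasure_eq_measure)
  also have "\<dots> < ennreal e" using UK(5) by (simp add: ennreal_lessI e)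
  finally show thesis
    using UK C S W by (intro that[of "U \<inter> W"]) auto
qed

section \<open>Countable families and doubling\<close>

lemma emeasure_UN_le_nn_integral_count_space:
  assumes "countable I" and [measurable]: "\<And>i. i \<in> I \<Longrightarrow> X i \<in> sets M"
  shows "emeasure M (\<Union>i\<in>I. X i) \<le> (\<integral>\<^sup>+i. emeasure M (X i) \<partial>count_space I)"
proof -
  have "(\<Union>i\<in>I. X i) \<in> sets M" using assms by auto
  then have "emeasure M (\<Union>i\<in>I. X i) = (\<integral>\<^sup>+x. indicator (\<Union>i\<in>I. X i) x \<partial>M)"
    by simp
  also have "\<dots> \<le> (\<integral>\<^sup>+x. \<integral>\<^sup>+i. indicator (X i) x \<partial>count_space I \<partial>M)"
  proof (rule nn_integral_mono)
    fix x
    show "indicator (\<Union>i\<in>I. X i) x \<le> (\<integral>\<^sup>+i. indicator (X i) x \<partial>count_space I)"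
    proof (cases "x \<in> (\<Union>i\<in>I. X i)")
      case True
      then obtain i where "i \<in> I" "x \<in> X i" by auto
      with nn_integral_ge_point[of i I "\<lambda>i. indicator (X i) x"] True show ?thesis by simp
    qed simp
  qed
  also have "\<dots> = (\<integral>\<^sup>+i. \<integral>\<^sup>+x. indicator (X i) x \<partial>M \<partial>count_space I)"
    using assms by (intro nn_integral_count_space_nn_integral) auto
  also have "\<dots> = (\<integral>\<^sup>+i. emeasure M (X i) \<partial>count_space I)"
    by (intro nn_integral_cong) simp
  finally show ?thesis .
qed

lemma countable_disjoint_positive_measure:
  assumes disj: "disjoint_family_on X I" and meas: "\<And>i. i \<in> I \<Longrightarrow> X i \<in> sets M"
    and pos: "\<And>i. i \<in> I \<Longrightarrow> 0 < emeasure M (X i)"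
    and W: "W \<in> sets M" "emeasure M W < \<infinity>" "\<And>i. i \<in> I \<Longrightarrow> X i \<subseteq> W"
  shows "countable I"
proof -
  have fin: "emeasure M (X i) \<noteq> \<infinity>" if "i \<in> I" for i
    using emeasure_mono[OF W(3)[OF that] W(1)] W(2) by (auto simp: top_unique)
  have "sum (\<lambda>i. measure M (X i)) J \<le> measure M W" if "J \<subseteq> I" "finite J" for J
  proof -
    have "sum (\<lambda>i. measure M (X i)) J = measure M (\<Union>i\<in>J. X i)"
      using that meas fin disj
      by (intro measure_finite_Union[symmetric]) (auto intro: disjoint_family_on_mono)
    also have "\<dots> \<le> measure M W"
      using that meas W by (intro measure_mono_fmeasurable) (auto simp: fmeasurable_def)
    finally show ?thesis .
  qed
  then have "(\<lambda>i. measure M (X i)) summable_on I"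
    by (intro nonneg_bdd_above_summable_on) (auto simp: bdd_above_def)
  from summable_countable_real[OF this] have "countable {i\<in>I. measure M (X i) \<noteq> 0}" .
  also have "{i\<in>I. measure M (X i) \<noteq> 0} = I"
    using pos fin by (force simp: measure_def enn2real_eq_0_iff)
  finally show ?thesis .
qed

lemma doublingD:
  assumes "doubling M c" "0 < r"
  shows "0 < emeasure M (ball x r)" "emeasure M (ball x r) < \<infinity>"
    "emeasure M (ball x (2 * r)) \<le> ennreal c * emeasure M (ball x r)"
  using assms unfolding doubling_def by blast+

lemma doubling_5:
  fixes M :: "'a::metric_space measure"
  assumes "borel_regular M" and db: "doubling M c" and r: "0 < r"
  shows "emeasure M (ball x (5 * r)) \<le> ennreal (c ^ 3) * emeasure M (ball x r)"
proof -
  have c: "1 \<le> c" using db by (simp add: doubling_def)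
  have "emeasure M (ball x (5 * r)) \<le> emeasure M (ball x (2 * (2 * (2 * r))))"
    using assms by (intro emeasure_mono subset_ball) (auto simp: borel_regular_def)
  also have "\<dots> \<le> ennreal c * emeasure M (ball x (2 * (2 * r)))"
    using r by (intro doublingD[OF db]) auto
  also have "\<dots> \<le> ennreal c * (ennreal c * emeasure M (ball x (2 * r)))"
    using r by (intro mult_left_mono doublingD[OF db]) auto
  also have "\<dots> \<le> ennreal c * (ennreal c * (ennreal c * emeasure M (ball x r)))"
    using r by (intro mult_left_mono doublingD[OF db]) auto
  also have "\<dots> = ennreal (c ^ 3) * emeasure M (ball x r)"
    using c by (simp add: power3_eq_cube ennreal_mult mult.assoc)
  finally show ?thesis .
qed

section \<open>One-sided Lebesgue differentiation\<close>

text \<open>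
  Chebyshev's inequality gives \<open>t \<mu>(B \<inter> S) \<le> lam \<mu>(B)\<close>; subtract this from
  \<open>t \<mu>(B)\<close>. For \<open>lam < t\<close> the estimate says that a fixed proportion of \<open>B\<close> lies outside \<open>S\<close>.
\<close>

lemma average_le_imp_large_complement:
  fixes M :: "'a::metric_space measure"
  assumes f: "\<And>x. 0 \<le> f x" and int: "set_integrable M B f"
    and B: "B \<in> sets M" "0 < emeasure M B" "emeasure M B < \<infinity>"
    and S: "S \<in> sets M" "\<And>x. x \<in> S \<Longrightarrow> t \<le> f x"
    and av: "average M f B \<le> lam" and t: "0 \<le> t" "lam \<le> t"
  shows "ennreal (t - lam) * emeasure M B \<le> ennreal t * emeasure M (B - S)"
proof -
  have fB: "B \<in> fmeasurable M" using B by (simp add: fmeasurable_def)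
  have fBS: "B \<inter> S \<in> fmeasurable M" "B - S \<in> fmeasurable M"
    using fB S by (auto intro: fmeasurable_Int_fmeasurable fmeasurable_Diff)
  have pos: "0 < measure M B"
    using B by (simp add: measure_def enn2real_positive_iff)
  have "t * measure M (B \<inter> S) = (LINT x|M. t * indicator (B \<inter> S) x)"
    using fBS by simp
  also have "\<dots> \<le> (LINT x:B|M. f x)"
    unfolding set_lebesgue_integral_def
    using int fBS S(2) f
    by (intro integral_mono) (auto simp: set_integrable_def fmeasurable_def split: split_indicator)
  also have "\<dots> \<le> lam * measure M B"
    using av pos by (simp add: average_def field_simps)
  finally have "t * measure M (B \<inter> S) \<le> lam * measure M B" .
  moreover have "measure M B = measure M (B \<inter> S) + measure M (B - S)"
    using measure_Un2[of "B \<inter> S" M B] fB fBS by (simp add: Un_absorb1 Diff_Int)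
  ultimately have "(t - lam) * measure M B \<le> t * measure M (B - S)"
    by (simp add: algebra_simps)
  then have "ennreal ((t - lam) * measure M B) \<le> ennreal (t * measure M (B - S))"
    by (rule ennreal_leI)
  then show ?thesis
    using t fB fBS by (simp add: ennreal_mult emeasure_eq_measure2)
qed

text \<open>
  Let \<open>S\<close> be a measurable hull of the exceptional set and \<open>U\<close> an open superset of \<open>S\<close> with
  \<open>\<mu>(U - S) < e\<close>. Choose disjoint small balls in \<open>U\<close> with averages at most \<open>lam\<close> whose enlargements
  cover the exceptional set. They carry a fixed proportion of \<open>\<mu>(S)\<close> by doubling, and each has a
  fixed proportion of its measure outside \<open>S\<close>. So \<open>\<mu>(S)\<close> is at most a constant times \<open>e\<close>, for
  every \<open>e > 0\<close>.
\<close>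

lemma AE_superlevel_average_gt:
  fixes M :: "'a::metric_space measure"
  assumes br: "borel_regular M" and db: "doubling M c" and f: "\<And>x. 0 \<le> f x"
    and loc: "locally_integrable M f" and lam: "0 \<le> lam" "lam < t" and R: "0 < R"
  shows "AE x in M. \<not> (x \<in> ball x0 R \<and> t < f x \<and>
    (\<forall>d>0. \<exists>r. 0 < r \<and> r < d \<and> average M f (ball x r) \<le> lam))"
proof -
  define W where "W = ball x0 R"
  define A where "A = {x\<in>W. t < f x \<and> (\<forall>d>0. \<exists>r. 0 < r \<and> r < d \<and> average M f (ball x r) \<le> lam)}"
  have sb: "sets borel \<subseteq> sets M" and sp: "space M = UNIV"
    using br by (auto simp: borel_regular_def)
  have ballM [measurable]: "ball x r \<in> sets M" for x r using sb by auto
  have W: "open W" "emeasure M W < \<infinity>" "W \<in> sets M"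
    using doublingD[OF db R] by (auto simp: W_def)
  have c: "1 \<le> c" using db by (simp add: doubling_def)
  define E where "E = {x\<in>space M. t < indicator W x *\<^sub>R f x}"
  have EM: "E \<in> sets M"
    using loc R unfolding E_def locally_integrable_def set_integrable_def W_def
    by (intro borel_measurable_less) auto
  have E: "x \<in> E \<longleftrightarrow> x \<in> W \<and> t < f x" for x
    using lam sp by (auto simp: E_def split: split_indicator)
  \<comment> \<open>\<open>A\<close> itself need not be measurable, so it is replaced by a measurable hull inside \<open>E\<close>.\<close>
  obtain S where S: "S \<in> sets M" "A \<subseteq> S" "S \<subseteq> E" "emeasure M S = outer_measure_of M A"
  proof -
    obtain H where H: "H \<in> sets M" "A \<subseteq> H" "outer_measure_of M A = emeasure M H"
      using outer_measure_of_attain[of A M] sp by auto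
    have "outer_measure_of M A \<le> outer_measure_of M (H \<inter> E)"
      using H by (intro outer_measure_of_mono) (auto simp: E A_def)
    moreover have "emeasure M (H \<inter> E) \<le> emeasure M H"
      using H by (intro emeasure_mono) auto
    ultimately show thesis
      using H EM by (intro that[of "H \<inter> E"]) (auto simp: E A_def)
  qed
  have key: "ennreal (t - lam) * emeasure M S \<le> ennreal (c ^ 3 * t) * ennreal e" if e: "0 < e" for e
  proof -
    have SW: "S \<subseteq> W" using S E by auto
    obtain U where U: "open U" "S \<subseteq> U" "U \<subseteq> W" "emeasure M (U - S) < ennreal e"
      using open_outer_approx[OF br W(1,2) S(1) SW e] by blast
    have UM: "U \<in> sets M" using sb U by auto
    have fU: "emeasure M U < \<infinity>"
      using emeasure_mono[OF U(3) W(3)] W(2) by (rule le_less_trans)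
    define F where "F = {(x, r). 0 < r \<and> r \<le> 1 \<and> x \<in> A \<and> ball x r \<subseteq> U \<and> average M f (ball x r) \<le> lam}"
    obtain D where D: "D \<subseteq> F" "disjoint_family_on (\<lambda>(x, r). ball x r) D"
      "\<And>x r. (x, r) \<in> F \<Longrightarrow> \<exists>(y, s)\<in>D. ball x r \<subseteq> ball y (5 * s)"
    proof (rule vitali_5r_covering)
      show "0 < r" "r \<le> 1" if "(x, r) \<in> F" for x r using that by (auto simp: F_def)
    qed blast
    have Dprop: "0 < snd p" "ball (fst p) (snd p) \<subseteq> U" "average M f (ball (fst p) (snd p)) \<le> lam"
      if "p \<in> D" for p
      using subsetD[OF D(1) that] by (auto simp: F_def case_prod_unfold)
    have disj: "disjoint_family_on (\<lambda>p. ball (fst p) (snd p)) D"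
      using D(2) by (simp add: case_prod_unfold)
    have cD: "countable D"
      by (rule countable_disjoint_positive_measure[OF disj _ _ UM fU])
        (use Dprop doublingD(1)[OF db] in auto)
    have cover: "A \<subseteq> (\<Union>p\<in>D. ball (fst p) (5 * snd p))"
    proof
      fix x assume x: "x \<in> A"
      then obtain d where d: "0 < d" "ball x d \<subseteq> U"
        using U(1,2) S(2) open_contains_ball[of U] by blast
      obtain r where r: "0 < r" "r < min d 1" "average M f (ball x r) \<le> lam"
      proof -
        have "\<forall>d>0. \<exists>r. 0 < r \<and> r < d \<and> average M f (ball x r) \<le> lam" and "0 < min d 1"
          using x d(1) by (auto simp: A_def)
        then show thesis using that by blast
      qed
      have "ball x r \<subseteq> U" using d(2) r(2) subset_ball[of r d x] by auto
      with r x have "(x, r) \<in> F" by (auto simp: F_def)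
      from D(3)[OF this] r(1) show "x \<in> (\<Union>p\<in>D. ball (fst p) (5 * snd p))" by force
    qed
    have "ennreal (t - lam) * emeasure M S \<le> ennreal (t - lam) * emeasure M (\<Union>p\<in>D. ball (fst p) (5 * snd p))"
    proof (rule mult_left_mono)
      have "(\<Union>p\<in>D. ball (fst p) (5 * snd p)) \<in> sets M" using cD by auto
      with outer_measure_of_mono[OF cover, of M] S(4)
      show "emeasure M S \<le> emeasure M (\<Union>p\<in>D. ball (fst p) (5 * snd p))" by simp
    qed simp
    also have "\<dots> \<le> ennreal (t - lam) * (\<integral>\<^sup>+p. emeasure M (ball (fst p) (5 * snd p)) \<partial>count_space D)"
      using cD by (intro mult_left_mono emeasure_UN_le_nn_integral_count_space) auto
    also have "\<dots> = (\<integral>\<^sup>+p. ennreal (t - lam) * emeasure M (ball (fst p) (5 * snd p)) \<partial>count_space D)"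
      by (simp add: nn_integral_cmult)
    also have "\<dots> \<le> (\<integral>\<^sup>+p. ennreal (c ^ 3 * t) * emeasure M (ball (fst p) (snd p) - S) \<partial>count_space D)"
    proof (rule nn_integral_mono)
      fix p assume "p \<in> space (count_space D)"
      then have p: "p \<in> D" by simp
      let ?B = "ball (fst p) (snd p)"
      have "ennreal (t - lam) * emeasure M (ball (fst p) (5 * snd p))
          \<le> ennreal (t - lam) * (ennreal (c ^ 3) * emeasure M ?B)"
        using Dprop(1)[OF p] by (intro mult_left_mono doubling_5[OF br db]) auto
      also have "\<dots> = ennreal (c ^ 3) * (ennreal (t - lam) * emeasure M ?B)"
        by (simp add: ac_simps)
      also have "\<dots> \<le> ennreal (c ^ 3) * (ennreal t * emeasure M (?B - S))"
      proof (intro mult_left_mono average_le_imp_large_complement[OF f])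
        show "set_integrable M ?B f" using loc Dprop(1)[OF p] by (simp add: locally_integrable_def)
        show "0 < emeasure M ?B" "emeasure M ?B < \<infinity>"
          using doublingD[OF db Dprop(1)[OF p]] by auto
        show "t \<le> f x" if "x \<in> S" for x using that S(3) E by (auto intro: less_imp_le)
        show "average M f ?B \<le> lam" using Dprop(3)[OF p] .
      qed (use S lam in auto)
      also have "\<dots> = ennreal (c ^ 3 * t) * emeasure M (?B - S)"
        using c lam by (simp add: ennreal_mult mult.assoc)
      finally show "ennreal (t - lam) * emeasure M (ball (fst p) (5 * snd p))
          \<le> ennreal (c ^ 3 * t) * emeasure M (?B - S)" .
    qed
    also have "\<dots> = ennreal (c ^ 3 * t) * emeasure M (\<Union>p\<in>D. ball (fst p) (snd p) - S)"
    proof -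
      have "disjoint_family_on (\<lambda>p. ball (fst p) (snd p) - S) D"
        using disj unfolding disjoint_family_on_def by blast
      then show ?thesis
        using cD S(1) by (subst emeasure_UN_countable) (auto simp: nn_integral_cmult)
    qed
    also have "\<dots> \<le> ennreal (c ^ 3 * t) * ennreal e"
    proof (rule mult_left_mono)
      have "emeasure M (\<Union>p\<in>D. ball (fst p) (snd p) - S) \<le> emeasure M (U - S)"
        using Dprop(2) UM S(1) by (intro emeasure_mono) auto
      with U(4) show "emeasure M (\<Union>p\<in>D. ball (fst p) (snd p) - S) \<le> ennreal e" by simp
    qed simp
    finally show ?thesis .
  qed
  have "emeasure M S = 0"
  proof (rule ccontr)
    assume "emeasure M S \<noteq> 0"
    have "emeasure M S < \<infinity>"
      using emeasure_mono[of S W M] W S E by (auto intro: le_less_trans)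
    then obtain m where m: "emeasure M S = ennreal m" "0 \<le> m"
      by (cases "emeasure M S") auto
    with \<open>emeasure M S \<noteq> 0\<close> have "0 < m" by (cases "m = 0") auto
    define a where "a = (t - lam) * m"
    define b where "b = c ^ 3 * t"
    \<comment> \<open>The choice \<open>e = a / (2 * b)\<close> turns the estimate into \<open>a \<le> a / 2\<close>.\<close>
    have ab: "0 < a" "0 < b" using \<open>0 < m\<close> lam c by (auto simp: a_def b_def)
    have "ennreal a \<le> ennreal (b * (a / (2 * b)))"
      using key[of "a / (2 * b)"] ab m lam by (simp add: a_def[symmetric] b_def[symmetric] ennreal_mult[symmetric])
    then show False using ab by (simp add: ennreal_le_iff)
  qed
  then have "AE x in M. x \<notin> S"
    using S(1) by (intro AE_not_in) auto
  then show ?thesis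
    by eventually_elim (use S(2) in \<open>unfold A_def W_def, blast\<close>)
qed

lemma AE_le_if_small_averages_le:
  fixes M :: "'a::metric_space measure"
  assumes br: "borel_regular M" and db: "doubling M c" and f: "\<And>x. 0 \<le> f x"
    and loc: "locally_integrable M f" and lam: "0 \<le> lam"
  shows "AE x in M. (\<forall>d>0. \<exists>r. 0 < r \<and> r < d \<and> average M f (ball x r) \<le> lam) \<longrightarrow> f x \<le> lam"
proof -
  fix x0 :: 'a
  have "AE x in M. \<forall>n k. \<not> (x \<in> ball x0 (real (Suc n)) \<and> lam + 1 / Suc k < f x \<and>
    (\<forall>d>0. \<exists>r. 0 < r \<and> r < d \<and> average M f (ball x r) \<le> lam))"
    unfolding AE_all_countable
    by (intro allI AE_superlevel_average_gt[OF br db f loc lam]) auto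
  then show ?thesis
  proof eventually_elim
    case (elim x)
    show ?case
    proof (intro impI, rule ccontr)
      assume small: "\<forall>d>0. \<exists>r. 0 < r \<and> r < d \<and> average M f (ball x r) \<le> lam"
        and "\<not> f x \<le> lam"
      then obtain k where "1 / real (Suc k) < f x - lam"
        using nat_approx_posE[of "f x - lam"] by auto
      moreover obtain n where "dist x0 x < real n" using reals_Archimedean2 by blast
      ultimately show False
        using spec[OF spec[OF elim, of n], of k] small by simp
    qed
  qed
qed

section \<open>Comparison of averages\<close>

lemma set_integral_nonneg:
  fixes f :: "'a \<Rightarrow> real"
  assumes "\<And>x. 0 \<le> f x"
  shows "0 \<le> (LINT x:A|M. f x)"
  unfolding set_lebesgue_integral_def
  using assms by (intro Bochner_Integration.integral_nonneg) simp

lemma set_integral_mono_nonneg: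
  fixes f :: "'a \<Rightarrow> real"
  assumes int: "set_integrable M B f" and A: "A \<in> sets M" "A \<subseteq> B" and f: "\<And>x. 0 \<le> f x"
  shows "(LINT x:A|M. f x) \<le> (LINT x:B|M. f x)"
  unfolding set_lebesgue_integral_def
  using int set_integrable_subset[OF int A] A(2) f
  by (intro integral_mono) (auto simp: set_integrable_def split: split_indicator)

lemma measure_ball_pos:
  assumes "doubling M c" "0 < r"
  shows "0 < measure M (ball x r)"
  using doublingD(1,2)[OF assms, of x] by (simp add: measure_def enn2real_positive_iff)

lemma average_le_average_5:
  fixes M :: "'a::metric_space measure"
  assumes br: "borel_regular M" and db: "doubling M c" and f: "\<And>x. 0 \<le> f x"
    and loc: "locally_integrable M f" and r: "0 < r"
  shows "average M f (ball x r) \<le> c ^ 3 * average M f (ball x (5 * r))"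
proof -
  have c: "1 \<le> c" using db by (simp add: doubling_def)
  let ?m = "measure M (ball x r)" and ?m5 = "measure M (ball x (5 * r))"
  let ?I5 = "LINT y:ball x (5 * r)|M. f y"
  have m: "0 < ?m" "0 < ?m5" using r by (auto intro!: measure_ball_pos[OF db])
  have fin: "emeasure M (ball x r) \<noteq> \<infinity>" "emeasure M (ball x (5 * r)) \<noteq> \<infinity>"
    using doublingD(2)[OF db, of r x] doublingD(2)[OF db, of "5 * r" x] r by auto
  have "ennreal ?m5 \<le> ennreal (c ^ 3 * ?m)"
    using doubling_5[OF br db r, of x] c fin by (simp add: emeasure_eq_ennreal_measure ennreal_mult)
  then have m5: "?m5 \<le> c ^ 3 * ?m"
    using c by (subst (asm) ennreal_le_iff) auto
  have I5: "0 \<le> ?I5" using f by (rule set_integral_nonneg)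
  have "(LINT y:ball x r|M. f y) \<le> ?I5"
    using loc r br f
    by (intro set_integral_mono_nonneg) (auto simp: locally_integrable_def borel_regular_def)
  then have "average M f (ball x r) \<le> ?I5 / ?m"
    using m by (simp add: average_def divide_right_mono)
  also have "\<dots> \<le> ?I5 / (?m5 / c ^ 3)"
    using m m5 I5 c by (intro divide_left_mono) (auto simp: field_simps)
  also have "\<dots> = c ^ 3 * average M f (ball x (5 * r))"
    by (simp add: average_def)
  finally show ?thesis .
qed

section \<open>Stopping radii\<close>

text \<open>
  Ratio 5 makes the ball before the stopping ball exactly its Vitali enlargement. The
  starting radius \<open>10 R\<close> is chosen so that a ball centered in \<open>ball x0 R\<close> still contains
  \<open>ball x0 R\<close> and stays within \<open>ball x0 (11 * R)\<close>.
\<close>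

definition stopped :: "'a::metric_space measure \<Rightarrow> ('a \<Rightarrow> real) \<Rightarrow> real \<Rightarrow> real \<Rightarrow> 'a \<Rightarrow> bool" where
  "stopped M f R lam x \<longleftrightarrow> (\<exists>k. lam < average M f (ball x (10 * R / 5 ^ k)))"

text \<open>
  Only the values at points that satisfy \<open>stopped\<close> have a meaning.
\<close>

definition stop_index :: "'a::metric_space measure \<Rightarrow> ('a \<Rightarrow> real) \<Rightarrow> real \<Rightarrow> real \<Rightarrow> 'a \<Rightarrow> nat" where
  "stop_index M f R lam x = (LEAST k. lam < average M f (ball x (10 * R / 5 ^ k)))"

definition stop_radius :: "'a::metric_space measure \<Rightarrow> ('a \<Rightarrow> real) \<Rightarrow> real \<Rightarrow> real \<Rightarrow> 'a \<Rightarrow> real" where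
  "stop_radius M f R lam x = 10 * R / 5 ^ stop_index M f R lam x"

lemma average_stop_radius:
  "stopped M f R lam x \<Longrightarrow> lam < average M f (ball x (stop_radius M f R lam x))"
  unfolding stopped_def stop_radius_def stop_index_def by (rule LeastI_ex)

text \<open>
  Exceeding the higher level implies exceeding the lower one, so raising the level can only delay the
  stopping.
\<close>

lemma stopped_mono:
  assumes "0 < R" "lam \<le> lam'" "stopped M f R lam' x"
  shows "stopped M f R lam x" "stop_radius M f R lam' x \<le> stop_radius M f R lam x"
proof -
  have av: "lam < average M f (ball x (10 * R / 5 ^ stop_index M f R lam' x))"
    using average_stop_radius[OF assms(3)] assms(2) by (simp add: stop_radius_def)
  then show "stopped M f R lam x" by (auto simp: stopped_def)
  have "stop_index M f R lam x \<le> stop_index M f R lam' x"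
    using av unfolding stop_index_def[of M f R lam] by (rule Least_le)
  then show "stop_radius M f R lam' x \<le> stop_radius M f R lam x"
    unfolding stop_radius_def using assms(1)
    by (intro divide_left_mono power_increasing) auto
qed

text \<open>
  The inclusions \<open>ball x0 R \<subseteq> ball x (10 * R) \<subseteq> ball x0 (11 * R)\<close> bound the denominator of the
  average from below and its numerator from above. This is why a stopping index is never 0.
\<close>

lemma average_10_le:
  fixes M :: "'a::metric_space measure"
  assumes br: "borel_regular M" and db: "doubling M c" and f: "\<And>x. 0 \<le> f x"
    and loc: "locally_integrable M f" and R: "0 < R"
    and lam: "1 / measure M (ball x0 R) * (LINT y:ball x0 (11 * R)|M. f y) \<le> lam"
    and x: "x \<in> ball x0 R"
  shows "average M f (ball x (10 * R)) \<le> lam"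
proof -
  have bM: "ball z r \<in> sets M" for z r using br by (auto simp: borel_regular_def)
  have x': "dist x0 x < R" using x by simp
  have "ball x0 R \<subseteq> ball x (10 * R)"
  proof
    fix y assume "y \<in> ball x0 R"
    with x' R dist_triangle[of x y x0] show "y \<in> ball x (10 * R)" by (simp add: dist_commute)
  qed
  then have m: "measure M (ball x0 R) \<le> measure M (ball x (10 * R))"
    using bM doublingD(2)[OF db, of "10 * R" x] R
    by (intro measure_mono_fmeasurable) (auto simp: fmeasurable_def)
  have "ball x (10 * R) \<subseteq> ball x0 (11 * R)"
  proof
    fix y assume "y \<in> ball x (10 * R)"
    with x' dist_triangle[of x0 y x] show "y \<in> ball x0 (11 * R)" by simp
  qed
  then have I: "(LINT y:ball x (10 * R)|M. f y) \<le> (LINT y:ball x0 (11 * R)|M. f y)"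
    using loc R bM f by (intro set_integral_mono_nonneg) (auto simp: locally_integrable_def)
  have I0: "0 \<le> (LINT y:ball x (10 * R)|M. f y)" using f by (rule set_integral_nonneg)
  have "average M f (ball x (10 * R)) \<le> (LINT y:ball x0 (11 * R)|M. f y) / measure M (ball x0 R)"
    unfolding average_def using m I I0 measure_ball_pos[OF db R] by (intro frac_le) auto
  with lam show ?thesis by simp
qed

lemma stop_radius_bounds:
  assumes R: "0 < R" and st: "stopped M f R lam x" and top: "average M f (ball x (10 * R)) \<le> lam"
  shows "0 < stop_radius M f R lam x" "stop_radius M f R lam x \<le> 2 * R"
    "average M f (ball x (5 * stop_radius M f R lam x)) \<le> lam"
proof -
  let ?k = "stop_index M f R lam x"
  have "lam < average M f (ball x (10 * R / 5 ^ ?k))"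
    using average_stop_radius[OF st] by (simp add: stop_radius_def)
  with top have "?k \<noteq> 0" by (intro notI) simp
  then obtain j where j: "?k = Suc j" by (cases ?k) auto
  show "0 < stop_radius M f R lam x" using R by (simp add: stop_radius_def)
  have "2 * R / 5 ^ j \<le> 2 * R / 1"
    using R by (intro divide_left_mono) auto
  then show "stop_radius M f R lam x \<le> 2 * R" by (simp add: stop_radius_def j)
  have "\<not> lam < average M f (ball x (10 * R / 5 ^ j))"
    using not_less_Least[of j "\<lambda>k. lam < average M f (ball x (10 * R / 5 ^ k))"] j
    by (simp add: stop_index_def)
  then show "average M f (ball x (5 * stop_radius M f R lam x)) \<le> lam"
    by (simp add: stop_radius_def j)
qed

section \<open>The Calderon--Zygmund families\<close>

definition stopping_balls ::
    "'a::metric_space measure \<Rightarrow> ('a \<Rightarrow> real) \<Rightarrow> 'a \<Rightarrow> real \<Rightarrow> real \<Rightarrow> ('a \<times> real) set" where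
  "stopping_balls M f x0 R lam =
     (\<lambda>x. (x, stop_radius M f R lam x)) ` {x \<in> ball x0 R. stopped M f R lam x}"

definition vitali_subfamily :: "('a::metric_space \<times> real) set \<Rightarrow> ('a \<times> real) set \<Rightarrow> bool" where
  "vitali_subfamily F D \<longleftrightarrow> D \<subseteq> F \<and> disjoint_family_on (\<lambda>(x, r). ball x r) D \<and>
     (\<forall>(x, r)\<in>F. \<exists>(y, s)\<in>D. ball x r \<subseteq> ball y (5 * s))"

lemma CZ_balls_vitali_subfamily:
  fixes M :: "'a::metric_space measure"
  assumes br: "borel_regular M" and db: "doubling M c" and f: "\<And>x. 0 \<le> f x"
    and loc: "locally_integrable M f" and R: "0 < R"
    and lam: "1 / measure M (ball x0 R) * (LINT y:ball x0 (11 * R)|M. f y) \<le> lam"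
    and D: "vitali_subfamily (stopping_balls M f x0 R lam) D"
  shows "CZ_balls M c f x0 R lam D"
proof -
  have bM: "ball z r \<in> sets M" for z r using br by (auto simp: borel_regular_def)
  have c: "1 \<le> c" using db by (simp add: doubling_def)
  have "0 \<le> (LINT y:ball x0 (11 * R)|M. f y)" using f by (rule set_integral_nonneg)
  then have "0 \<le> 1 / measure M (ball x0 R) * (LINT y:ball x0 (11 * R)|M. f y)" by simp
  with lam have lam0: "0 \<le> lam" by linarith
  have disj: "disjoint_family_on (\<lambda>(x, r). ball x r) D"
    using D by (simp add: vitali_subfamily_def)
  have ball: "0 < r" "x \<in> ball x0 R" "ball x (5 * r) \<subseteq> ball x0 (11 * R)"
      "lam < average M f (ball x r)" "average M f (ball x (5 * r)) \<le> lam"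
    if "(x, r) \<in> D" for x r
  proof -
    from that D have x: "x \<in> ball x0 R" "stopped M f R lam x" "r = stop_radius M f R lam x"
      by (auto simp: vitali_subfamily_def stopping_balls_def)
    note b = stop_radius_bounds[OF R x(2) average_10_le[OF br db f loc R lam x(1)]]
    from b x average_stop_radius[OF x(2)] show "0 < r" "x \<in> ball x0 R"
      "lam < average M f (ball x r)" "average M f (ball x (5 * r)) \<le> lam" by auto
    show "ball x (5 * r) \<subseteq> ball x0 (11 * R)"
    proof
      fix y assume "y \<in> ball x (5 * r)"
      with b(2) x dist_triangle[of x0 y x] show "y \<in> ball x0 (11 * R)" by simp
    qed
  qed
  have avg: "average M f (ball x r) \<le> c ^ 3 * lam" "c powi (-3) * lam < average M f (ball x (5 * r))"
    if xr: "(x, r) \<in> D" for x r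
  proof -
    have c3: "0 < c ^ 3" using c by simp
    have 5: "average M f (ball x r) \<le> c ^ 3 * average M f (ball x (5 * r))"
      using ball(1)[OF xr] by (rule average_le_average_5[OF br db f loc])
    also have "\<dots> \<le> c ^ 3 * lam"
      using ball(5)[OF xr] c by (intro mult_left_mono) auto
    finally show "average M f (ball x r) \<le> c ^ 3 * lam" .
    have "lam < c ^ 3 * average M f (ball x (5 * r))" using ball(4)[OF xr] 5 by linarith
    then have "lam / c ^ 3 < average M f (ball x (5 * r))" using c3 by (simp add: field_simps)
    then show "c powi (-3) * lam < average M f (ball x (5 * r))"
      by (simp add: power_int_minus_divide)
  qed
  have "countable D"
  proof (rule countable_disjoint_positive_measure[OF disj])
    show "(case p of (x, r) \<Rightarrow> ball x r) \<in> sets M" for p by (auto simp: bM split: prod.split)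
    show "0 < emeasure M (case p of (x, r) \<Rightarrow> ball x r)" if "p \<in> D" for p
      using that ball(1) doublingD(1)[OF db] by (auto split: prod.split)
    show "ball x0 (11 * R) \<in> sets M" by (rule bM)
    show "emeasure M (ball x0 (11 * R)) < \<infinity>" using R by (intro doublingD[OF db]) auto
    show "(case p of (x, r) \<Rightarrow> ball x r) \<subseteq> ball x0 (11 * R)" if "p \<in> D" for p
    proof -
      obtain x r where p: "p = (x, r)" by (cases p)
      with that have "ball x r \<subseteq> ball x (5 * r)" using ball(1)[of x r] by (intro subset_ball) auto
      with p that ball(3)[of x r] show ?thesis by auto
    qed
  qed
  moreover have "AE x in M. x \<in> ball x0 R - (\<Union>(y, r)\<in>D. ball y (5 * r)) \<longrightarrow> f x \<le> lam"
    using AE_le_if_small_averages_le[OF br db f loc lam0]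
  proof eventually_elim
    case (elim x)
    show ?case
    proof
      assume x: "x \<in> ball x0 R - (\<Union>(y, r)\<in>D. ball y (5 * r))"
      have "\<not> stopped M f R lam x"
      proof
        assume st: "stopped M f R lam x"
        with x have "(x, stop_radius M f R lam x) \<in> stopping_balls M f x0 R lam"
          by (auto simp: stopping_balls_def)
        with D obtain y s where "(y, s) \<in> D" "ball x (stop_radius M f R lam x) \<subseteq> ball y (5 * s)"
          unfolding vitali_subfamily_def by blast
        moreover have "x \<in> ball x (stop_radius M f R lam x)"
          using R by (simp add: stop_radius_def)
        ultimately show False using x by blast
      qed
      then have avle: "average M f (ball x (10 * R / 5 ^ k)) \<le> lam" for k
        by (auto simp: stopped_def not_less)
      have "\<exists>r. 0 < r \<and> r < d \<and> average M f (ball x r) \<le> lam" if d: "0 < d" for d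
      proof -
        obtain k where "(1 / 5) ^ k < d / (10 * R)"
          using real_arch_pow_inv[of "d / (10 * R)" "1 / 5"] d R by auto
        then have "10 * R / 5 ^ k < d" using R by (simp add: field_simps power_divide)
        with avle[of k] R show ?thesis by (intro exI[of _ "10 * R / 5 ^ k"]) auto
      qed
      with elim show "f x \<le> lam" by blast
    qed
  qed
  ultimately show ?thesis
    using disj ball avg unfolding CZ_balls_def by blast
qed

lemma vitali_subfamily_nested:
  assumes R: "0 < R" and le: "lam \<le> lam'"
    and D: "vitali_subfamily (stopping_balls M f x0 R lam) D"
    and D': "vitali_subfamily (stopping_balls M f x0 R lam') D'" and xr: "(x, r) \<in> D'"
  shows "\<exists>(y, s)\<in>D. ball x r \<subseteq> ball y (5 * s)"
proof -
  from D' xr have x: "x \<in> ball x0 R" "stopped M f R lam' x" "r = stop_radius M f R lam' x"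
    by (auto simp: vitali_subfamily_def stopping_balls_def)
  note mono = stopped_mono[OF R le x(2)]
  have "(x, stop_radius M f R lam x) \<in> stopping_balls M f x0 R lam"
    using x(1) mono(1) by (auto simp: stopping_balls_def)
  with D obtain y s where "(y, s) \<in> D" "ball x (stop_radius M f R lam x) \<subseteq> ball y (5 * s)"
    unfolding vitali_subfamily_def by blast
  moreover have "ball x r \<subseteq> ball x (stop_radius M f R lam x)"
    using mono(2) x(3) by (intro subset_ball) simp
  ultimately show ?thesis by blast
qed

theorem lemma3p8:
  fixes M :: "'a::metric_space measure" and c :: real and f :: "'a \<Rightarrow> real"
    and x0 :: 'a and R :: real and lam0 :: real
  assumes "borel_regular M"
    and "doubling M c"
    and "\<And>x. 0 \<le> f x"
    and "locally_integrable M f"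
    and "R > 0"
    and "lam0 \<ge> 1 / measure M (ball x0 R) * (LINT y:ball x0 (11 * R)|M. f y)"
  shows "(\<exists>F. CZ_balls M c f x0 R lam0 F) \<and>
    (\<forall>(N::nat) (lev::nat \<Rightarrow> real).
       lev 0 = lam0 \<and> (\<forall>n<N. lev n \<le> lev (Suc n)) \<longrightarrow>
       (\<exists>G. (\<forall>n\<le>N. CZ_balls M c f x0 R (lev n) (G n)) \<and>
            (\<forall>n<N. \<forall>(x, r)\<in>G (Suc n). \<exists>(y, s)\<in>G n. ball x r \<subseteq> ball y (5 * s))))"
proof -
  have "\<exists>D. lam0 \<le> lam \<longrightarrow> vitali_subfamily (stopping_balls M f x0 R lam) D" for lam
  proof (cases "lam0 \<le> lam")
    case True
    then have lam: "1 / measure M (ball x0 R) * (LINT y:ball x0 (11 * R)|M. f y) \<le> lam"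
      using assms(6) by linarith
    have b: "0 < r \<and> r \<le> 2 * R" if xr: "(x, r) \<in> stopping_balls M f x0 R lam" for x r
    proof -
      from xr have x: "x \<in> ball x0 R" "stopped M f R lam x" "r = stop_radius M f R lam x"
        by (auto simp: stopping_balls_def)
      with stop_radius_bounds(1,2)[OF assms(5) x(2) average_10_le[OF assms(1-5) lam x(1)]]
      show ?thesis by simp
    qed
    obtain D where "D \<subseteq> stopping_balls M f x0 R lam" "disjoint_family_on (\<lambda>(x, r). ball x r) D"
      "\<And>x r. (x, r) \<in> stopping_balls M f x0 R lam \<Longrightarrow> \<exists>(y, s)\<in>D. ball x r \<subseteq> ball y (5 * s)"
    proof (rule vitali_5r_covering)
      show "0 < r" "r \<le> 2 * R" if "(x, r) \<in> stopping_balls M f x0 R lam" for x r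
        using b[OF that] by auto
    qed blast
    then have "vitali_subfamily (stopping_balls M f x0 R lam) D"
      unfolding vitali_subfamily_def by blast
    then show ?thesis by blast
  qed simp
  then obtain G where G: "\<And>lam. lam0 \<le> lam \<Longrightarrow> vitali_subfamily (stopping_balls M f x0 R lam) (G lam)"
    by metis
  have CZ: "CZ_balls M c f x0 R lam (G lam)" if "lam0 \<le> lam" for lam
    using assms(6) that by (intro CZ_balls_vitali_subfamily[OF assms(1-5) _ G[OF that]]) linarith
  have nested: "\<exists>(y, s)\<in>G lam. ball x r \<subseteq> ball y (5 * s)"
    if "lam0 \<le> lam" "lam \<le> lam'" "(x, r) \<in> G lam'" for lam lam' x r
    using vitali_subfamily_nested[OF assms(5) that(2) G G that(3)] that by simp
  have "\<exists>G. (\<forall>n\<le>N. CZ_balls M c f x0 R (lev n) (G n)) \<and>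
      (\<forall>n<N. \<forall>(x, r)\<in>G (Suc n). \<exists>(y, s)\<in>G n. ball x r \<subseteq> ball y (5 * s))"
    if lev: "lev 0 = lam0" "\<forall>n<N. lev n \<le> lev (Suc n)" for N :: nat and lev :: "nat \<Rightarrow> real"
  proof -
    have ge: "lam0 \<le> lev n" if "n \<le> N" for n
      using that
    proof (induction n)
      case (Suc n)
      with lev(2) have "lam0 \<le> lev n" "lev n \<le> lev (Suc n)" by auto
      then show ?case by linarith
    qed (simp add: lev)
    show ?thesis
    proof (intro exI[of _ "\<lambda>n. G (lev n)"] conjI allI impI)
      show "CZ_balls M c f x0 R (lev n) (G (lev n))" if "n \<le> N" for n
        using CZ[OF ge[OF that]] .
      show "\<forall>(x, r)\<in>G (lev (Suc n)). \<exists>(y, s)\<in>G (lev n). ball x r \<subseteq> ball y (5 * s)" if "n < N" for n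
        using nested[OF ge[of n]] lev(2) that by auto
    qed
  qed
  with CZ[OF order_refl] show ?thesis by blast
qed

end
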